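(* Let $n\ge1$ and let $F:V\to\mathbb{C}$ be a linear functional on $V=\mathbb{C}^{S_n}$ such that $$F(M_\phi(A))=\det(A)\quad\text{for all }A\in M_n(\mathbb{C}).$$ Then $F=L_\phi$.
   Context: Let $\omega=e^{2\pi i/n}$, let $S_n$ be the symmetric group on $\{1,\dots,n\}$ with composition $(\sigma\circ\tau)(i)=\sigma(\tau(i))$, let $\varepsilon(\sigma)$ be the sign of $\sigma$, and let $\rho=(1\,2\,\cdots\,n)$ be the cycle $\rho(i)=i+1$ for $i<n$, $\rho(n)=1$. Each orbit $\{\sigma\circ\rho^r: r\in\mathbb{Z}/n\mathbb{Z}\}$ contains exactly one permutation $\sigma^*$ with $\sigma^*(1)=1$. The orbital phase $\phi:S_n\to\mathbb{Z}/n\mathbb{Z}$ is the unique function such that $\phi(\sigma^*\circ\rho^r)=r$ for every $\sigma^*\in S_n$ with $\sigma^*(1)=1$ and every $r\in\mathbb{Z}/n\mathbb{Z}$. For $A=(a_{ij})\in M_n(\mathbb{C})$ put $m_\sigma(A)=\varepsilon(\sigma)\prod_{i=1}^n a_{i,\sigma(i)}$. Let $V=\mathbb{C}^{S_n}$ be the space of functions $S_n\to\mathbb{C}$ with canonical basis $\{\delta_\sigma\}$, $\delta_\sigma(\tau)=1$ if $\tau=\sigma$ and $0$ otherwise. The phased monomial vector is $M_\phi(A)=\sum_{\sigma\in S_n}m_\sigma(A)\,\omega^{\phi(\sigma)}\,\delta_\sigma\in V$. The readout functional is the linear map $L_\phi:V\to\mathbb{C}$, $L_\phi(f)=\sum_{\sigma\in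 S_n}\omega^{-\phi(\sigma)}f(\sigma)$. *)

theory Defs
  imports
    "HOL-Combinatorics.Permutations"
    "HOL-Analysis.Complex_Transcendental"
    "Jordan_Normal_Form.Determinant"
begin

definition Sym :: "nat \<Rightarrow> (nat \<Rightarrow> nat) set" where
  "Sym n = {\<sigma>. \<sigma> permutes {1..n}}"

definition omega :: "nat \<Rightarrow> complex" where
  "omega n = exp (2 * of_real pi * \<i> / of_nat n)"

definition rho :: "nat \<Rightarrow> nat \<Rightarrow> nat" where
  "rho n i = (if 1 \<le> i \<and> i < n then i + 1 else if i = n then 1 else i)"

(* Elements of Z/nZ are represented by their residues 0, ..., n - 1; the phase only ever
   occurs as an exponent of omega n, which is an n-th root of unity. *)
definition phase :: "nat \<Rightarrow> (nat \<Rightarrow> nat) \<Rightarrow> nat" where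
  "phase n \<sigma> =
     (THE r. r < n \<and> (\<exists>\<tau>\<in>Sym n. \<tau> 1 = 1 \<and> \<sigma> = \<tau> \<circ> (rho n ^^ r)))"

lemma rho_funpow:
  assumes "1 \<le> j" "j \<le> n"
  shows "(rho n ^^ r) j = (j - 1 + r) mod n + 1"
proof (induction r)
  case 0
  with assms show ?case by simp
next
  case (Suc r)
  have "(j - 1 + r) mod n < n" using assms by simp
  with Suc show ?case
    by (auto simp: rho_def mod_Suc)
qed

(* The description in the definition of phase is never vacuous on Sym n: the
   characterising equation holds, and every permutation is of the required form. *)
lemma phase_comp_rho:
  assumes n: "n \<ge> 1" and t: "\<tau> \<in> Sym n" "\<tau> 1 = 1" and r: "r < n"
  shows "phase n (\<tau> \<circ> (rho n ^^ r)) = r"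
  unfolding phase_def
proof (rule the_equality)
  show "r < n \<and> (\<exists>\<tau>'\<in>Sym n. \<tau>' 1 = 1 \<and> \<tau> \<circ> (rho n ^^ r) = \<tau>' \<circ> (rho n ^^ r))"
    using t r by blast
next
  fix s
  assume "s < n \<and> (\<exists>\<tau>'\<in>Sym n. \<tau>' 1 = 1 \<and> \<tau> \<circ> (rho n ^^ r) = \<tau>' \<circ> (rho n ^^ s))"
  then obtain \<tau>' where s: "s < n" and t': "\<tau>' \<in> Sym n" "\<tau>' 1 = 1"
    and eq: "\<tau> \<circ> (rho n ^^ r) = \<tau>' \<circ> (rho n ^^ s)" by blast
  define j where "j = (if r = 0 then 1 else n - r + 1)"
  have j: "1 \<le> j" "j \<le> n" using n r by (auto simp: j_def)
  have "(j - 1 + r) mod n = 0" using r by (auto simp: j_def)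
  with rho_funpow[OF j, of r] have "(rho n ^^ r) j = 1" by simp
  with eq t t' have "\<tau>' ((rho n ^^ s) j) = \<tau>' 1" by (metis comp_apply)
  moreover have "inj \<tau>'" using t' by (auto simp: Sym_def intro: permutes_inj)
  ultimately have "(rho n ^^ s) j = 1" by (auto dest: injD)
  with rho_funpow[OF j, of s] have 0: "(j - 1 + s) mod n = 0" by simp
  show "s = r"
  proof (cases "r = 0")
    case True
    with 0 s show ?thesis by (simp add: j_def)
  next
    case False
    with 0 have "(n - r + s) mod n = 0" by (simp add: j_def)
    then obtain k where k: "n - r + s = n * k" by (auto elim: dvdE simp: mod_eq_0_iff_dvd)
    have "n * k < n * 2" using k s r False by linarith
    moreover have "n * k > 0" using k r by linarith
    ultimately have "k = 1" by (cases k) auto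
    with k r show ?thesis by simp
  qed
qed

lemma rho_permutes:
  assumes "n \<ge> 1"
  shows "rho n permutes {1..n}"
proof (rule bij_imp_permutes)
  have "inj_on (rho n) {1..n}" by (auto simp: inj_on_def rho_def split: if_splits)
  moreover have "rho n ` {1..n} \<subseteq> {1..n}" by (auto simp: rho_def)
  ultimately show "bij_betw (rho n) {1..n} {1..n}"
    by (simp add: bij_betw_def endo_inj_surj)
qed (use assms in \<open>auto simp: rho_def\<close>)

lemma Sym_orbit_rep:
  assumes n: "n \<ge> 1" and s: "\<sigma> \<in> Sym n"
  shows "\<exists>r<n. \<exists>\<tau>\<in>Sym n. \<tau> 1 = 1 \<and> \<sigma> = \<tau> \<circ> (rho n ^^ r)"
proof -
  have s': "\<sigma> permutes {1..n}" using s by (simp add: Sym_def)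
  then obtain j where j: "j \<in> {1..n}" "\<sigma> j = 1"
    using n by (metis atLeastAtMost_iff order_refl permutes_in_image permutes_surj surjD)
  define r where "r = (if j = 1 then 0 else n + 1 - j)"
  have r: "r < n" using j n by (auto simp: r_def)
  have "(j - 1 + r) mod n = 0" using j by (auto simp: r_def)
  with j have rj: "(rho n ^^ r) j = 1" by (simp add: rho_funpow)
  have p: "(rho n ^^ r) permutes {1..n}"
    using rho_permutes[OF n] by (induction r) (auto intro: permutes_compose simp: permutes_id[unfolded id_def] id_def)
  define \<tau> where "\<tau> = \<sigma> \<circ> Hilbert_Choice.inv (rho n ^^ r)"
  have "\<tau> \<in> Sym n"
    unfolding \<tau>_def Sym_def using permutes_compose[OF permutes_inv[OF p] s'] by simp
  moreover have "\<tau> 1 = 1"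
    using j rj permutes_inverses(2)[OF p, of j] by (simp add: \<tau>_def)
  moreover have "\<sigma> = \<tau> \<circ> (rho n ^^ r)"
    by (rule ext) (simp add: \<tau>_def permutes_inverses(2)[OF p])
  ultimately show ?thesis using r by blast
qed

(* Matrix indices start at 0, permutations act on {1..n}. *)
definition monomial :: "nat \<Rightarrow> complex mat \<Rightarrow> (nat \<Rightarrow> nat) \<Rightarrow> complex" where
  "monomial n A \<sigma> = of_int (sign \<sigma>) * (\<Prod>i=1..n. A $$ (i - 1, \<sigma> i - 1))"

(* The functions on Sym n, each extended by zero outside Sym n. *)
definition V :: "nat \<Rightarrow> ((nat \<Rightarrow> nat) \<Rightarrow> complex) set" where
  "V n = {f. \<forall>\<sigma>. \<sigma> \<notin> Sym n \<longrightarrow> f \<sigma> = 0}"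

definition delta :: "(nat \<Rightarrow> nat) \<Rightarrow> (nat \<Rightarrow> nat) \<Rightarrow> complex" where
  "delta \<sigma> \<tau> = (if \<tau> = \<sigma> then 1 else 0)"

definition phased_monomial_vector :: "nat \<Rightarrow> complex mat \<Rightarrow> (nat \<Rightarrow> nat) \<Rightarrow> complex" where
  "phased_monomial_vector n A =
     (\<lambda>\<tau>. \<Sum>\<sigma>\<in>Sym n. monomial n A \<sigma> * omega n ^ phase n \<sigma> * delta \<sigma> \<tau>)"

definition readout :: "nat \<Rightarrow> ((nat \<Rightarrow> nat) \<Rightarrow> complex) \<Rightarrow> complex" where
  "readout n f = (\<Sum>\<sigma>\<in>Sym n. omega n powi (- int (phase n \<sigma>)) * f \<sigma>)"

definition linear_functional_on_V :: "nat \<Rightarrow> (((nat \<Rightarrow> nat) \<Rightarrow> complex) \<Rightarrow> complex) \<Rightarrow> bool" where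
  "linear_functional_on_V n F \<longleftrightarrow>
     (\<forall>f\<in>V n. \<forall>g\<in>V n. F (\<lambda>\<sigma>. f \<sigma> + g \<sigma>) = F f + F g) \<and>
     (\<forall>c. \<forall>f\<in>V n. F (\<lambda>\<sigma>. c * f \<sigma>) = c * F f)"

end

theory Submission
  imports Defs
begin

text \<open>
  The values of the phased monomial vector span the whole space, so the equation
  \<open>F (M\<^sub>\<phi> A) = det A\<close> leaves no freedom for \<open>F\<close>. Already permutation matrices suffice: the only
  generalised diagonal without a zero entry in the permutation matrix \<open>P\<close> of \<open>\<tau>\<close> is the one
  along \<open>\<tau>\<close>, so \<open>M\<^sub>\<phi> P\<close> is the single basis vector \<open>\<delta>\<^sub>\<tau>\<close> scaled by \<open>\<epsilon>(\<tau>) \<omega>\<^bsup>\<phi>(\<tau>)\<^esup>\<close>, while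
  \<open>det P = \<epsilon>(\<tau>)\<close>. The signs cancel and \<open>F \<delta>\<^sub>\<tau> = \<omega>\<^bsup>-\<phi>(\<tau>)\<^esup>\<close>, which is the coefficient of
  \<open>f \<tau>\<close> in the readout functional.
\<close>

lemma finite_Sym: "finite (Sym n)"
  by (simp add: Sym_def finite_permutations)

lemma delta_in_V: "\<sigma> \<in> Sym n \<Longrightarrow> delta \<sigma> \<in> V n"
  by (auto simp: V_def delta_def)

lemma linear_functional_sum:
  assumes F: "linear_functional_on_V n F" and "finite S" and "\<And>s. s \<in> S \<Longrightarrow> g s \<in> V n"
  shows "F (\<lambda>\<tau>. \<Sum>s\<in>S. c s * g s \<tau>) = (\<Sum>s\<in>S. c s * F (g s))"
  using assms(2,3)
proof (induction S rule: finite_induct)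
  case empty
  have hom: "F (\<lambda>\<sigma>. a * h \<sigma>) = a * F h" if "h \<in> V n" for a h
    using F that unfolding linear_functional_on_V_def by blast
  show ?case using hom[of "\<lambda>\<tau>. 0" 0] by (simp add: V_def)
next
  case (insert s S)
  have g: "g t \<in> V n" if "t \<in> insert s S" for t using insert.prems that .
  then have "(\<lambda>\<tau>. c s * g s \<tau>) \<in> V n" "(\<lambda>\<tau>. \<Sum>t\<in>S. c t * g t \<tau>) \<in> V n"
    by (auto simp: V_def intro!: sum.neutral)
  moreover have "F (\<lambda>\<sigma>. h \<sigma> + k \<sigma>) = F h + F k" if "h \<in> V n" "k \<in> V n" for h k
    using F that unfolding linear_functional_on_V_def by blast
  ultimately have "F (\<lambda>\<tau>. c s * g s \<tau> + (\<Sum>t\<in>S. c t * g t \<tau>))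
      = F (\<lambda>\<tau>. c s * g s \<tau>) + F (\<lambda>\<tau>. \<Sum>t\<in>S. c t * g t \<tau>)"
    by simp
  moreover have "F (\<lambda>\<tau>. c s * g s \<tau>) = c s * F (g s)"
    using F g unfolding linear_functional_on_V_def by blast
  ultimately show ?case using insert by simp
qed

lemma linear_functional_basis_expansion:
  assumes F: "linear_functional_on_V n F" and f: "f \<in> V n"
  shows "F f = (\<Sum>\<sigma>\<in>Sym n. f \<sigma> * F (delta \<sigma>))"
proof -
  have "f = (\<lambda>\<tau>. \<Sum>\<sigma>\<in>Sym n. f \<sigma> * delta \<sigma> \<tau>)"
  proof
    fix \<tau>
    have "(\<Sum>\<sigma>\<in>Sym n. f \<sigma> * delta \<sigma> \<tau>) = (\<Sum>\<sigma>\<in>Sym n. if \<tau> = \<sigma> then f \<sigma> else 0)"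
      by (intro sum.cong) (simp_all add: delta_def)
    also have "\<dots> = f \<tau>" using f by (simp add: finite_Sym V_def)
    finally show "f \<tau> = (\<Sum>\<sigma>\<in>Sym n. f \<sigma> * delta \<sigma> \<tau>)" ..
  qed
  then show ?thesis
    using linear_functional_sum[OF F finite_Sym, of n delta f] delta_in_V by metis
qed

definition perm_mat :: "nat \<Rightarrow> (nat \<Rightarrow> nat) \<Rightarrow> complex mat" where
  "perm_mat n \<tau> = mat n n (\<lambda>(i, j). if \<tau> (Suc i) = Suc j then 1 else 0)"

lemma perm_mat_carrier: "perm_mat n \<tau> \<in> carrier_mat n n"
  by (simp add: perm_mat_def)

text \<open>
  The permutation matrix is the identity matrix with its rows permuted by the copy of \<open>\<tau>\<close> on
  the index range \<open>{0..<n}\<close>; transport along the shift \<open>i \<mapsto> i - 1\<close> preserves the sign.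
\<close>
lemma det_perm_mat:
  assumes "\<tau> \<in> Sym n"
  shows "det (perm_mat n \<tau>) = of_int (sign \<tau>)"
proof -
  have \<tau>: "\<tau> permutes {1..n}" using assms by (simp add: Sym_def)
  let ?shift = "\<lambda>i::nat. i - 1"
  define p where "p = map_permutation {1..n} ?shift \<tau>"
  have bij: "bij_betw ?shift {1..n} {0..<n}"
    by (rule bij_betw_byWitness[where f' = Suc]) auto
  then have inj: "inj_on ?shift {1..n}" by (rule bij_betw_imp_inj_on)
  have p: "p permutes {0..<n}"
    unfolding p_def using bij \<tau> by (rule map_permutation_permutes)
  have p_eq: "Suc (p i) = \<tau> (Suc i)" if "i < n" for i
  proof -
    have "p i = \<tau> (Suc i) - 1"
      using map_permutation_apply[OF inj, of "Suc i" \<tau>] that by (simp add: p_def)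
    moreover have "\<tau> (Suc i) \<in> {1..n}"
      using permutes_in_image[OF \<tau>, of "Suc i"] that by simp
    ultimately show ?thesis by simp
  qed
  have "perm_mat n \<tau> = mat n n (\<lambda>(i, j). 1\<^sub>m n $$ (p i, j))"
  proof (rule eq_matI)
    fix i j assume "i < dim_row (mat n n (\<lambda>(i, j). 1\<^sub>m n $$ (p i, j) :: complex))"
      and "j < dim_col (mat n n (\<lambda>(i, j). 1\<^sub>m n $$ (p i, j) :: complex))"
    then have ij: "i < n" "j < n" by simp_all
    moreover have "p i < n" using permutes_in_image[OF p, of i] ij by simp
    ultimately show "perm_mat n \<tau> $$ (i, j) = mat n n (\<lambda>(i, j). 1\<^sub>m n $$ (p i, j)) $$ (i, j)"
      by (simp add: perm_mat_def p_eq[symmetric])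
  qed (simp_all add: perm_mat_def)
  then have "det (perm_mat n \<tau>) = of_int (sign p)"
    using det_permute_rows[OF one_carrier_mat p, where 'a = complex] by simp
  also have "sign p = sign \<tau>"
    unfolding p_def using inj \<tau> by (rule sign_map_permutation) simp
  finally show ?thesis .
qed

lemma monomial_perm_mat:
  assumes \<sigma>: "\<sigma> \<in> Sym n" and \<tau>: "\<tau> \<in> Sym n"
  shows "monomial n (perm_mat n \<tau>) \<sigma> = (if \<sigma> = \<tau> then of_int (sign \<tau>) else 0)"
proof -
  have perm: "\<sigma> permutes {1..n}" "\<tau> permutes {1..n}" using \<sigma> \<tau> by (simp_all add: Sym_def)
  have entry: "perm_mat n \<tau> $$ (i - 1, \<sigma> i - 1) = (if \<tau> i = \<sigma> i then 1 else 0)"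
    if "i \<in> {1..n}" for i
  proof -
    have "\<sigma> i \<in> {1..n}" using permutes_in_image[OF perm(1)] that by blast
    then have "i - 1 < n" "\<sigma> i - 1 < n" "Suc (i - 1) = i" "Suc (\<sigma> i - 1) = \<sigma> i"
      using that by auto
    then show ?thesis by (simp add: perm_mat_def)
  qed
  show ?thesis
  proof (cases "\<sigma> = \<tau>")
    case True
    then show ?thesis using entry by (simp add: monomial_def)
  next
    case False
    \<comment> \<open>both fix everything outside \<open>{1..n}\<close>, so they differ inside\<close>
    then obtain i where "\<sigma> i \<noteq> \<tau> i" by blast
    moreover from this have "i \<in> {1..n}" using perm by (metis permutes_not_in)
    ultimately have "(\<Prod>i=1..n. perm_mat n \<tau> $$ (i - 1, \<sigma> i - 1)) = 0"
      using entry by (intro prod_zero) (auto intro!: bexI[of _ i])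
    then show ?thesis using False by (simp add: monomial_def)
  qed
qed

lemma phased_monomial_vector_perm_mat:
  assumes \<tau>: "\<tau> \<in> Sym n"
  shows "phased_monomial_vector n (perm_mat n \<tau>)
    = (\<lambda>\<upsilon>. (of_int (sign \<tau>) * omega n ^ phase n \<tau>) * delta \<tau> \<upsilon>)"
proof
  fix \<upsilon>
  have "phased_monomial_vector n (perm_mat n \<tau>) \<upsilon> = (\<Sum>\<sigma>\<in>Sym n.
      if \<sigma> = \<tau> then of_int (sign \<tau>) * omega n ^ phase n \<tau> * delta \<tau> \<upsilon> else 0)"
    unfolding phased_monomial_vector_def using \<tau>
    by (intro sum.cong) (auto simp: monomial_perm_mat)
  then show "phased_monomial_vector n (perm_mat n \<tau>) \<upsilon>
      = (of_int (sign \<tau>) * omega n ^ phase n \<tau>) * delta \<tau> \<upsilon>"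
    using \<tau> by (simp add: finite_Sym)
qed

theorem corollary2p6:
  fixes n :: nat and F :: "((nat \<Rightarrow> nat) \<Rightarrow> complex) \<Rightarrow> complex"
  assumes "n \<ge> 1"
    and "linear_functional_on_V n F"
    and "\<And>A :: complex mat. A \<in> carrier_mat n n \<Longrightarrow> F (phased_monomial_vector n A) = det A"
  shows "\<forall>f\<in>V n. F f = readout n f"
proof
  fix f assume f: "f \<in> V n"
  have basis: "F (delta \<tau>) = omega n powi (- int (phase n \<tau>))" if \<tau>: "\<tau> \<in> Sym n" for \<tau>
  proof -
    have "of_int (sign \<tau>) = F (phased_monomial_vector n (perm_mat n \<tau>))"
      using assms(3)[OF perm_mat_carrier] det_perm_mat[OF \<tau>] by simp
    also have "\<dots> = (of_int (sign \<tau>) * omega n ^ phase n \<tau>) * F (delta \<tau>)"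
      unfolding phased_monomial_vector_perm_mat[OF \<tau>]
      using assms(2) delta_in_V[OF \<tau>] unfolding linear_functional_on_V_def by blast
    finally have "omega n ^ phase n \<tau> * F (delta \<tau>) = 1" by (simp add: mult.assoc)
    moreover have "omega n \<noteq> 0" by (simp add: omega_def)
    ultimately show ?thesis by (simp add: power_int_minus field_simps)
  qed
  have "F f = (\<Sum>\<sigma>\<in>Sym n. f \<sigma> * F (delta \<sigma>))"
    using assms(2) f by (rule linear_functional_basis_expansion)
  also have "\<dots> = readout n f"
    unfolding readout_def by (intro sum.cong) (simp_all add: basis)
  finally show "F f = readout n f" .
qed

end
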